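(* Let $G$ be a compact group and let $\mu=(\mu_k)_{k\in-\mathbf N}$ be an arbitrary sequence of Borel probability measures on $G$ (a noise law). Then there exists a solution $\mathbf P^*_\mu\in\mathcal P_\mu$ of the equation $\eta_k=\eta_{k-1}\cdot\xi_k$, $k\in-\mathbf N$, with noise law $\mu$, such that all marginal distributions of $\mathbf P^*_\mu$ are uniform, i.e. $\mathbf P^*_\mu(\eta_k\in\cdot)=\nu$ for every $k\in-\mathbf N$, where $\nu$ is the normalized Haar measure on $G$. If $G\neq\{e\}$, then the solution $\mathbf P^*_\mu$ is non-strong.
   Context: $-\mathbf N=\{0,-1,-2,\dots\}$; $e$ is the unit of $G$. On $G^{-\mathbf N}$ let $\eta=(\eta_k)_{k\in-\mathbf N}$ be the coordinate process, $\eta_k(\omega)=\omega(k)$, and set $\xi_k=(\eta_{k-1})^{-1}\cdot\eta_k$ for $k\in-\mathbf N$. Let $\mathcal F^\eta_k=\sigma(\eta_k,\eta_{k-1},\dots)$ and $\mathcal F^\xi_k=\sigma(\xi_k,\xi_{k-1},\dots)$. A solution with noise law $\mu$ is a probability measure $\mathbf P$ on $G^{-\mathbf N}$ such that, for every $k\in-\mathbf N$, under $\mathbf P$: (i) $\xi_k$ is independent of $\mathcal F^\eta_{k-1}$; (ii) $\xi_k$ has law $\mu_k$. The set of all solutions is denoted $\mathcal P_\mu$. A solution $\mathbf P$ is strong if $\mathcal F^\eta_k\subset\mathcal F^\xi_k$ up to $\mathbf P$-null sets for every $k\in-\mathbf N$; otherwise it is non-strong. *)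

theory Defs
  imports "HOL-Probability.Probability"
begin

text \<open>
  Topological groups are types of the class \<^class>\<open>topological_group_add\<close>. Despite the additive
  notation, this class does not assume commutativity: \<open>x + y\<close> is the product of the group, \<open>- x\<close>
  the inverse and \<open>0\<close> the unit. A compact group is such a type which is moreover Hausdorff and
  has a compact carrier \<open>UNIV\<close>; no countability axiom is imposed.

  Negative time is reversed: the index \<open>n :: nat\<close> stands for \<open>k = - n\<close>, so that the predecessor
  \<open>k - 1\<close> is \<open>Suc n\<close> and the past \<open>k, k - 1, ...\<close> consists of all \<open>m \<ge> n\<close>.
\<close>

text \<open>
  Left invariant regular Borel probability measure. On a compact group it exists, is unique and is
  also right invariant. Regularity is automatic in the metrizable case only.
\<close>

definition normalized_haar :: "'a::{topological_group_add, t2_space} measure \<Rightarrow> bool" where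
  "normalized_haar \<nu> \<longleftrightarrow>
     prob_space \<nu> \<and> sets \<nu> = sets borel \<and>
     (\<forall>g. distr \<nu> borel (\<lambda>x. g + x) = \<nu>) \<and>
     (\<forall>A \<in> sets borel. emeasure \<nu> A = (INF U \<in> {U. open U \<and> A \<subseteq> U}. emeasure \<nu> U)) \<and>
     (\<forall>U. open U \<longrightarrow> emeasure \<nu> U = (SUP K \<in> {K. compact K \<and> K \<subseteq> U}. emeasure \<nu> K))"

definition noise_law :: "(nat \<Rightarrow> 'a::topological_space measure) \<Rightarrow> bool" where
  "noise_law \<mu> \<longleftrightarrow> (\<forall>n. prob_space (\<mu> n) \<and> sets (\<mu> n) = sets borel)"

definition eta :: "nat \<Rightarrow> (nat \<Rightarrow> 'a) \<Rightarrow> 'a" where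
  "eta n \<omega> = \<omega> n"

definition xi :: "nat \<Rightarrow> (nat \<Rightarrow> 'a::group_add) \<Rightarrow> 'a" where
  "xi n \<omega> = - eta (Suc n) \<omega> + eta n \<omega>"

definition sigma_rv :: "('b \<Rightarrow> 'a::topological_space) \<Rightarrow> 'b set set" where
  "sigma_rv X = {X -` B | B. B \<in> sets borel}"

definition F_eta :: "nat \<Rightarrow> (nat \<Rightarrow> 'a::topological_space) set set" where
  "F_eta n = sigma_sets UNIV (\<Union>m\<in>{n..}. sigma_rv (eta m))"

definition F_xi :: "nat \<Rightarrow> (nat \<Rightarrow> 'a::{topological_space, group_add}) set set" where
  "F_xi n = sigma_sets UNIV (\<Union>m\<in>{n..}. sigma_rv (xi m))"

text \<open>
  The measurable space of paths carries the smallest \<open>\<sigma>\<close>-algebra for which all \<open>eta n\<close> and all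
  \<open>xi n\<close> are random variables with values in the Borel space of the group. If the group is second
  countable, this is the product of the Borel \<open>\<sigma>\<close>-algebras (see \<open>sets_path_space_eq_PiM\<close> below).
  Without second countability the group operation, and hence \<open>xi n\<close>, need not be measurable for
  the product of the Borel \<open>\<sigma>\<close>-algebras.
\<close>

definition path_space :: "(nat \<Rightarrow> 'a::{topological_space, group_add}) measure" where
  "path_space = sigma UNIV (\<Union>n. sigma_rv (eta n) \<union> sigma_rv (xi n))"

definition solutions ::
  "(nat \<Rightarrow> 'a::{topological_space, group_add} measure) \<Rightarrow> (nat \<Rightarrow> 'a) measure set" where
  "solutions \<mu> = {P. prob_space P \<and> sets P = sets path_space \<and>
     (\<forall>n. prob_space.indep_set P (sigma_rv (xi n)) (F_eta (Suc n)) \<and>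
          distr P borel (xi n) = \<mu> n)}"

definition strong_solution ::
  "(nat \<Rightarrow> 'a::{topological_space, group_add}) measure \<Rightarrow> bool" where
  "strong_solution P \<longleftrightarrow>
     (\<forall>n. \<forall>A \<in> F_eta n. \<exists>B \<in> F_xi n. (A - B) \<union> (B - A) \<in> null_sets P)"

lemma sets_path_space:
  "sets path_space = sigma_sets UNIV (\<Union>n. sigma_rv (eta n) \<union> sigma_rv (xi n))"
  by (simp add: path_space_def)

lemma space_path_space: "space path_space = UNIV"
  by (simp add: path_space_def)

lemma measurable_eta [measurable]: "eta n \<in> measurable path_space borel"
  by (rule measurableI)
     (auto simp: space_path_space sets_path_space sigma_rv_def intro!: sigma_sets.Basic)

lemma measurable_xi [measurable]: "xi n \<in> measurable path_space borel"
  by (rule measurableI)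
     (auto simp: space_path_space sets_path_space sigma_rv_def intro!: sigma_sets.Basic)

lemma sets_path_space_eq_PiM:
  "sets (path_space :: (nat \<Rightarrow> 'a::{topological_group_add, second_countable_topology}) measure) =
   sets (PiM UNIV (\<lambda>_. borel))"
proof
  let ?M = "PiM UNIV (\<lambda>_. borel) :: (nat \<Rightarrow> 'a) measure"
  have eta: "eta n \<in> measurable ?M borel" for n
    unfolding eta_def by measurable
  have "continuous_on UNIV (uminus :: 'a \<Rightarrow> 'a)"
    by (intro continuous_intros)
  then have [measurable]: "(uminus :: 'a \<Rightarrow> 'a) \<in> measurable borel borel"
    by (rule borel_measurable_continuous_onI)
  have xi: "xi n \<in> measurable ?M borel" for n
    using eta[measurable] unfolding xi_def by measurable
  have sp: "space ?M = UNIV"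
    by (simp add: space_PiM)
  show "sets (path_space :: (nat \<Rightarrow> 'a) measure) \<subseteq> sets ?M"
    unfolding sets_path_space
    using measurable_sets[OF eta] measurable_sets[OF xi] sets.sigma_sets_subset[of _ ?M]
    by (intro sets.sigma_sets_subset[of _ ?M, unfolded sp]) (auto simp: sigma_rv_def sp)
  have "(\<lambda>\<omega>. \<lambda>n\<in>UNIV. eta n \<omega>) \<in> measurable (path_space :: (nat \<Rightarrow> 'a) measure) ?M"
    by (intro measurable_restrict measurable_eta)
  then have id: "(\<lambda>\<omega>. \<omega>) \<in> measurable (path_space :: (nat \<Rightarrow> 'a) measure) ?M"
    by (simp add: eta_def restrict_def)
  show "sets ?M \<subseteq> sets (path_space :: (nat \<Rightarrow> 'a) measure)"
    using measurable_sets[OF id] by (auto simp: space_path_space)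
qed

end

theory Submission
  imports Defs
begin

text \<open>
  In the uniform solution the present value \<open>\<eta>\<^sub>0\<close> carries no information about the noise: it is
  Haar distributed and independent of the whole sequence \<open>\<xi>\<close>. As the equation determines the past
  from \<open>\<eta>\<^sub>0\<close> and \<open>\<xi>\<close> (in reversed time, \<open>\<eta> (n + 1) = \<eta> n - \<xi> n\<close>), this description can serve as a
  construction. Draw the noise \<open>y\<close> from the product measure of the \<open>\<mu> n\<close>, and given \<open>y\<close> let the path
  be \<open>trajectory x y\<close>, whose value at \<open>n\<close> is \<open>x - y 0 - \<dots> - y (n - 1)\<close>, with \<open>x\<close> Haar distributed.
  The solution \<open>P\<close> is this mixture over \<open>y\<close> (\<open>haar_solution\<close>), so that \<open>P C\<close> is the integral over
  \<open>y\<close> of the Haar measure of the fibre \<open>{x. trajectory x y \<in> C}\<close>.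

  Everything follows from right invariance of Haar measure. Given \<open>y\<close>, the value at time \<open>n\<close> is a
  right translate of \<open>x\<close>, hence uniform. Replacing \<open>y n\<close> by another value has the same effect on
  the path at the indices \<open>m > n\<close> as a right translation of \<open>x\<close>, so for an event \<open>C\<close> about these
  indices (the past of \<open>\<xi>\<^sub>n\<close>) the measure of the fibre does not depend on \<open>y n\<close>
  (\<open>fibre_resample\<close>); this is the independence of \<open>\<xi>\<^sub>n\<close> from the past. If \<open>C\<close> is an event about
  the noise, its fibres are empty or everything, so \<open>\<eta>\<^sub>0\<close> is independent of the noise. Were the
  solution strong, the events \<open>\<eta>\<^sub>0 \<in> U\<close> would be independent of themselves and have probability
  0 or 1, whereas a nontrivial Hausdorff group has an open set \<open>U\<close> of Haar measure strictly between.

  Two points need care because the group may fail to be second countable. First, sums of random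
  elements may fail to be measurable for products of Borel \<open>\<sigma>\<close>-algebras, so the integral over \<open>y\<close>
  has to be justified. Where \<open>y\<close> meets the conditions that a cylinder puts on the noise, the measure
  of the fibre is a continuous function of \<open>y\<close>, because \<open>z \<mapsto> \<nu> {x. x + z \<in> A}\<close>, and likewise the
  measure of a finite intersection of such translates, is continuous by regularity of \<open>\<nu>\<close>; and a
  continuous real function \<open>h\<close> on a product of compact spaces is measurable for the product
  \<open>\<sigma>\<close>-algebra, since by compactness countably many open boxes make up each of the sets \<open>h > a\<close>.
  Secondly, right invariance is deduced from left invariance by Fubini's theorem, which is applied
  to continuous functions for the same reason.
\<close>

section \<open>Continuous functions on products of compact spaces\<close>

text \<open>
  In general an open set is a union of uncountably many basic sets and need not be measurable. The set
  \<open>h > a\<close> is a countable union of the compact sets \<open>h \<ge> a + 1/k\<close>, and each of these is covered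
  by finitely many basic sets inside \<open>h > a\<close>.
\<close>

lemma continuous_imp_measurable_of_basis:
  fixes h :: "'x::topological_space \<Rightarrow> real"
  assumes "compact (UNIV :: 'x set)" and B: "topological_basis B" "B \<subseteq> sets M"
    and "space M = UNIV" and h: "continuous_on UNIV h"
  shows "h \<in> borel_measurable M"
  unfolding borel_measurable_iff_greater
proof
  fix a :: real
  define W where "W = {w. a < h w}"
  have "open W"
    using h unfolding W_def by (intro open_Collect_less continuous_intros)
  then obtain C where C: "C \<subseteq> B" "\<Union>C = W"
    using B(1) unfolding topological_basis_def by metis
  have "\<exists>F. F \<subseteq> C \<and> finite F \<and> {w. a + 1 / real (Suc k) \<le> h w} \<subseteq> \<Union>F" for k
  proof -
    have "closed {w. a + 1 / real (Suc k) \<le> h w}"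
      using h by (intro closed_Collect_le continuous_intros)
    then have "compact {w. a + 1 / real (Suc k) \<le> h w}"
      using assms(1) compact_Int_closed[of UNIV "{w. a + 1 / real (Suc k) \<le> h w}"] by simp
    moreover have "a + 1 / real (Suc k) \<le> h w \<Longrightarrow> a < h w" for w
      by (rule less_le_trans[of _ "a + 1 / real (Suc k)"]) auto
    then have "{w. a + 1 / real (Suc k) \<le> h w} \<subseteq> \<Union>C"
      unfolding C W_def by blast
    moreover have "\<And>T. T \<in> C \<Longrightarrow> open T"
      using C(1) topological_basis_open[OF B(1)] by blast
    ultimately obtain F where "F \<subseteq> C" "finite F" "{w. a + 1 / real (Suc k) \<le> h w} \<subseteq> \<Union>F"
      by (meson compactE)
    then show ?thesis by blast
  qed
  then obtain F where F: "\<And>k. F k \<subseteq> C" "\<And>k. finite (F k)"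
    "\<And>k. {w. a + 1 / real (Suc k) \<le> h w} \<subseteq> \<Union>(F k)"
    by metis
  have "W = (\<Union>k. \<Union>(F k))"
  proof
    show "W \<subseteq> (\<Union>k. \<Union>(F k))"
    proof
      fix w assume "w \<in> W"
      then obtain k where "1 / real (Suc k) < h w - a"
        using nat_approx_posE[of "h w - a"] by (auto simp: W_def)
      then have "w \<in> {w. a + 1 / real (Suc k) \<le> h w}" by simp
      then show "w \<in> (\<Union>k. \<Union>(F k))" using F(3) by blast
    qed
  qed (use F(1) C(2) in blast)
  also have "\<dots> \<in> sets M"
    using F(1,2) C(1) B(2) by (intro sets.countable_UN image_subsetI sets.finite_Union) (blast | simp)+
  finally show "{w \<in> space M. a < h w} \<in> sets M"
    by (simp add: W_def assms(4))
qed

lemma continuous_imp_measurable_pair: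
  fixes h :: "'a::topological_space \<times> 'b::topological_space \<Rightarrow> real"
  assumes "compact (UNIV :: 'a set)" "compact (UNIV :: 'b set)"
    and [measurable_cong, simp]: "sets M = sets borel" "sets N = sets borel"
    and h: "continuous_on UNIV h"
  shows "h \<in> borel_measurable (M \<Otimes>\<^sub>M N)"
proof (rule continuous_imp_measurable_of_basis[OF _ _ _ _ h])
  have "compact ((UNIV :: 'a set) \<times> (UNIV :: 'b set))"
    by (intro compact_Times assms)
  then show "compact (UNIV :: ('a \<times> 'b) set)" by simp
  show "topological_basis ((\<lambda>(a, b). a \<times> b) ` ({S :: 'a set. open S} \<times> {S :: 'b set. open S}))"
    by (intro topological_basis_prod) (auto simp: topological_basis_def intro!: exI[of _ "{_}"])
  show "(\<lambda>(a, b). a \<times> b) ` ({S. open S} \<times> {S. open S}) \<subseteq> sets (M \<Otimes>\<^sub>M N)"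
    by auto
  show "space (M \<Otimes>\<^sub>M N) = UNIV"
    using assms(3,4)[THEN sets_eq_imp_space_eq] by (simp add: space_pair_measure)
qed

lemma continuous_imp_measurable_PiM:
  fixes h :: "(nat \<Rightarrow> 'a::topological_space) \<Rightarrow> real"
  assumes "compact (UNIV :: 'a set)"
    and M: "\<And>i. sets (M i) = sets borel"
    and h: "continuous_on UNIV h"
  shows "h \<in> borel_measurable (PiM UNIV M)"
proof (rule continuous_imp_measurable_of_basis[OF _ _ _ _ h])
  have sp: "space (M i) = UNIV" for i
    using M[THEN sets_eq_imp_space_eq] by simp
  have "compact_space (product_topology (\<lambda>i::nat. euclidean :: 'a topology) UNIV)"
    unfolding compact_space_product_topology using assms(1) by (simp add: compact_space_def)
  then show "compact (UNIV :: (nat \<Rightarrow> 'a) set)"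
    unfolding euclidean_product_topology compact_space_def by simp
  let ?B = "{Pi\<^sub>E UNIV X | X :: nat \<Rightarrow> 'a set. (\<forall>i. open (X i)) \<and> finite {i. X i \<noteq> UNIV}}"
  show "topological_basis ?B"
  proof (rule topological_basisI)
    fix B assume "B \<in> ?B"
    then show "open B" using open_PiE by blast
  next
    fix U :: "(nat \<Rightarrow> 'a) set" and x assume "open U" "x \<in> U"
    then obtain X where "x \<in> Pi\<^sub>E UNIV X" "\<And>i. open (X i)" "finite {i. X i \<noteq> UNIV}" "Pi\<^sub>E UNIV X \<subseteq> U"
      using product_topology_open_contains_basis[of "\<lambda>_. euclidean" UNIV U x]
      unfolding open_fun_def by auto
    then show "\<exists>B'\<in>?B. x \<in> B' \<and> B' \<subseteq> U" by blast
  qed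
  show "?B \<subseteq> sets (PiM UNIV M)"
    using M by (auto intro!: sets_PiM_I_countable)
  show "space (PiM UNIV M) = UNIV"
    by (simp add: space_PiM sp)
qed

section \<open>Right invariance of Haar measure\<close>

locale compact_group_haar =
  fixes \<nu> :: "'a::{topological_group_add, t2_space} measure"
  assumes compact_UNIV: "compact (UNIV :: 'a set)"
    and haar: "normalized_haar \<nu>"
begin

sublocale prob_space \<nu>
  using haar by (simp add: normalized_haar_def)

lemma sets_haar [measurable_cong, simp]: "sets \<nu> = sets borel"
  using haar by (simp add: normalized_haar_def)

lemma space_haar [simp]: "space \<nu> = UNIV"
  using sets_haar[THEN sets_eq_imp_space_eq] by simp

lemma emeasure_haar_UNIV [simp]: "emeasure \<nu> UNIV = 1"
  using emeasure_space_1 by simp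

lemma left_invariant: "distr \<nu> borel (\<lambda>x. g + x) = \<nu>"
  using haar by (simp add: normalized_haar_def)

lemma outer_regular:
  "A \<in> sets borel \<Longrightarrow> emeasure \<nu> A = (INF U \<in> {U. open U \<and> A \<subseteq> U}. emeasure \<nu> U)"
  using haar unfolding normalized_haar_def by blast

lemma inner_regular:
  "open U \<Longrightarrow> emeasure \<nu> U = (SUP K \<in> {K. compact K \<and> K \<subseteq> U}. emeasure \<nu> K)"
  using haar unfolding normalized_haar_def by blast

lemma measurable_continuous [measurable (raw)]: "continuous_on UNIV f \<Longrightarrow> f \<in> borel_measurable \<nu>"
  for f :: "'a \<Rightarrow> 'b::topological_space"
  by (subst measurable_cong_sets[OF sets_haar refl]) (rule borel_measurable_continuous_onI)

lemma nn_integral_left_translate: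
  assumes "f \<in> borel_measurable borel"
  shows "(\<integral>\<^sup>+ x. f (g + x) \<partial>\<nu>) = (\<integral>\<^sup>+ x. f x \<partial>\<nu>)"
proof -
  have "(\<integral>\<^sup>+ x. f x \<partial>\<nu>) = (\<integral>\<^sup>+ x. f x \<partial>distr \<nu> borel (\<lambda>x. g + x))"
    by (simp add: left_invariant)
  also have "\<dots> = (\<integral>\<^sup>+ x. f (g + x) \<partial>\<nu>)"
    using assms by (intro nn_integral_distr measurable_continuous continuous_intros) simp
  finally show ?thesis by simp
qed

text \<open>
  Integrate \<open>f (- x + y)\<close> over both variables: left invariance removes \<open>x\<close> from the integral over
  \<open>y\<close>, and, since \<open>- x + y = - (- y + x)\<close>, it removes \<open>y\<close> from the integral over \<open>x\<close>. The coercion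
  to \<open>ennreal\<close> truncates, so for functions of varying sign this concerns the positive part.
\<close>

lemma nn_integral_inverse_continuous:
  fixes f :: "'a \<Rightarrow> real"
  assumes f: "continuous_on UNIV f"
  shows "(\<integral>\<^sup>+ x. f (- x) \<partial>\<nu>) = (\<integral>\<^sup>+ x. f x \<partial>\<nu>)"
proof -
  have cf: "continuous_on UNIV (\<lambda>x. f (k x))" if "continuous_on UNIV k" for k :: "'a \<Rightarrow> 'a"
    using continuous_on_compose2[OF f that] by simp
  have bf: "(\<lambda>x. ennreal (f (k x))) \<in> borel_measurable borel" if "continuous_on UNIV k" for k :: "'a \<Rightarrow> 'a"
    using borel_measurable_continuous_onI[OF cf[OF that]] by measurable
  interpret pair_prob_space \<nu> \<nu> ..
  have "(\<lambda>p. f (- fst p + snd p)) \<in> borel_measurable (\<nu> \<Otimes>\<^sub>M \<nu>)"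
    by (intro continuous_imp_measurable_pair compact_UNIV sets_haar
        continuous_on_compose2[OF f] continuous_intros) auto
  then have "(\<integral>\<^sup>+ y. \<integral>\<^sup>+ x. f (- x + y) \<partial>\<nu> \<partial>\<nu>) = (\<integral>\<^sup>+ x. \<integral>\<^sup>+ y. f (- x + y) \<partial>\<nu> \<partial>\<nu>)"
    by (intro Fubini') (simp add: split_beta')
  moreover have "(\<integral>\<^sup>+ x. f (- x + y) \<partial>\<nu>) = (\<integral>\<^sup>+ x. f (- x) \<partial>\<nu>)" for y
    using nn_integral_left_translate[of "\<lambda>x. ennreal (f (- x))" "- y"] bf[of uminus]
    by (simp add: minus_add continuous_intros)
  moreover have "(\<integral>\<^sup>+ y. f (- x + y) \<partial>\<nu>) = (\<integral>\<^sup>+ y. f y \<partial>\<nu>)" for x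
    using nn_integral_left_translate[of "\<lambda>x. ennreal (f x)" "- x"] bf[of "\<lambda>x. x"]
    by (simp add: continuous_intros)
  ultimately show ?thesis
    by simp
qed

text \<open>
  Inversion exchanges left and right translations and preserves the integral.
\<close>

lemma nn_integral_right_translate_continuous:
  fixes f :: "'a \<Rightarrow> real"
  assumes f: "continuous_on UNIV f"
  shows "(\<integral>\<^sup>+ x. f (x + g) \<partial>\<nu>) = (\<integral>\<^sup>+ x. f x \<partial>\<nu>)"
proof -
  have cf: "continuous_on UNIV (\<lambda>x. f (k x))" if "continuous_on UNIV k" for k :: "'a \<Rightarrow> 'a"
    using continuous_on_compose2[OF f that] by simp
  have "(\<lambda>x. f (- x)) \<in> borel_measurable borel"
    by (intro borel_measurable_continuous_onI cf continuous_intros)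
  then have "(\<integral>\<^sup>+ x. f (- x + g) \<partial>\<nu>) = (\<integral>\<^sup>+ x. f (- x) \<partial>\<nu>)"
    using nn_integral_left_translate[of "\<lambda>x. ennreal (f (- x))" "- g"] by (simp add: minus_add)
  then show ?thesis
    using nn_integral_inverse_continuous[of "\<lambda>x. f (x + g)"] nn_integral_inverse_continuous[OF f]
    by (simp add: cf continuous_intros)
qed

text \<open>
  By inner regularity it suffices to compare with compact \<open>K \<subseteq> U\<close>; an Urysohn function between
  \<open>K\<close> and \<open>U\<close> transfers the invariance from integrals of continuous functions to sets.
\<close>

lemma open_translate_le:
  assumes "open U"
  shows "emeasure \<nu> U \<le> emeasure \<nu> {x. x + g \<in> U}"
proof -
  have "Hausdorff_space (euclidean :: 'a topology)"
    unfolding Hausdorff_space_def open_openin[symmetric] disjnt_def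
    using hausdorff[where 'a = 'a] by blast
  then have nrm: "normal_space (euclidean :: 'a topology)"
    using compact_UNIV
    by (intro compact_Hausdorff_or_regular_imp_normal_space) (auto simp: compact_space_def)
  have "emeasure \<nu> K \<le> emeasure \<nu> {x. x + g \<in> U}" if K: "compact K" "K \<subseteq> U" for K
  proof -
    have "closed K" "closed (- U)"
      using K assms by (auto intro: compact_imp_closed)
    then obtain f where f: "continuous_map euclidean (top_of_set {0..1::real}) f"
        "f ` K \<subseteq> {1}" "f ` (- U) \<subseteq> {0}"
      using Urysohn_lemma[OF nrm, of "- U" K 0 1] K(2)
      by (metis Diff_eq_empty_iff closed_closedin diff_eq disjnt_def inf_commute zero_le_one)
    then have cf: "continuous_on UNIV f" and f01: "0 \<le> f x" "f x \<le> 1" for x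
      by (auto simp: continuous_map_in_subtopology image_subset_iff Pi_iff)
    have "open {x. x + g \<in> U}"
      using open_vimage[OF assms, of "\<lambda>x. x + g"] by (simp add: vimage_def continuous_intros)
    then have [measurable]: "K \<in> sets borel" "{x. x + g \<in> U} \<in> sets borel"
      using \<open>closed K\<close> by auto
    have "emeasure \<nu> K = (\<integral>\<^sup>+ x. indicator K x \<partial>\<nu>)" by simp
    also have "\<dots> \<le> (\<integral>\<^sup>+ x. f x \<partial>\<nu>)"
      using f(2) by (intro nn_integral_mono) (auto simp: indicator_def)
    also have "\<dots> = (\<integral>\<^sup>+ x. f (x + g) \<partial>\<nu>)"
      using nn_integral_right_translate_continuous[OF cf] by simp
    also have "\<dots> \<le> (\<integral>\<^sup>+ x. indicator {x. x + g \<in> U} x \<partial>\<nu>)"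
    proof (intro nn_integral_mono)
      fix x
      have "f (x + g) = 0" if "x + g \<notin> U" using f(3) that by blast
      then show "ennreal (f (x + g)) \<le> indicator {x. x + g \<in> U} x"
        using f01(2)[of "x + g"] by (auto simp: indicator_def)
    qed
    also have "\<dots> = emeasure \<nu> {x. x + g \<in> U}" by simp
    finally show ?thesis .
  qed
  then show ?thesis
    unfolding inner_regular[OF assms] by (auto intro!: SUP_least)
qed

lemma right_invariant: "distr \<nu> borel (\<lambda>x. x + g) = \<nu>"
proof -
  have [measurable]: "(\<lambda>x. x + g) \<in> borel_measurable \<nu>" for g
    by (intro measurable_continuous continuous_intros)
  have em: "emeasure (distr \<nu> borel (\<lambda>x. x + g)) U = emeasure \<nu> U" if "open U" for U
  proof -
    have "open {x. x + g \<in> U}"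
      using open_vimage[OF that, of "\<lambda>x. x + g"] by (simp add: vimage_def continuous_intros)
    \<comment> \<open>The reverse inequality is the same one for the translated set and the inverse translation.\<close>
    then have "emeasure \<nu> {x. x + g \<in> U} \<le> emeasure \<nu> U"
      using open_translate_le[of "{x. x + g \<in> U}" "- g"] by simp
    then show ?thesis
      using open_translate_le[OF that, of g] that
      by (subst emeasure_distr) (auto simp: vimage_def)
  qed
  show ?thesis
  proof (rule measure_eqI_generator_eq[where E = "{S. open S}" and \<Omega> = UNIV and A = "\<lambda>_. UNIV"])
    show "Int_stable {S :: 'a set. open S}" by (auto simp: Int_stable_def)
    show "sets (distr \<nu> borel (\<lambda>x. x + g)) = sigma_sets UNIV {S. open S}"
      by (simp add: borel_def)
    show "sets \<nu> = sigma_sets UNIV {S. open S}"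
      unfolding sets_haar by (simp add: borel_def)
  qed (auto simp: em)
qed

lemma emeasure_right_translate:
  assumes "A \<in> sets borel"
  shows "emeasure \<nu> {x. x + g \<in> A} = emeasure \<nu> A"
proof -
  have "emeasure \<nu> A = emeasure (distr \<nu> borel (\<lambda>x. x + g)) A"
    by (simp add: right_invariant)
  also have "\<dots> = emeasure \<nu> {x. x + g \<in> A}"
    using assms by (subst emeasure_distr) (auto simp: vimage_def intro!: measurable_continuous continuous_intros)
  finally show ?thesis by simp
qed


section \<open>Continuity of translation in measure\<close>

lemma sets_right_translate:
  fixes A :: "'a set"
  assumes "A \<in> sets borel"
  shows "{x. x + g \<in> A} \<in> sets borel"
proof -
  have "continuous_on UNIV (\<lambda>x. x + g)"
    by (intro continuous_intros)
  then have "(\<lambda>x. x + g) -` A \<inter> space borel \<in> sets borel"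
    using assms by (rule measurable_sets[OF borel_measurable_continuous_onI])
  then show ?thesis by (simp add: vimage_def)
qed

lemma measure_right_translate:
  assumes "A \<in> sets borel"
  shows "measure \<nu> {x. x + g \<in> A} = measure \<nu> A"
  using emeasure_right_translate[OF assms] by (simp add: measure_def)

text \<open>
  Sandwich \<open>A\<close> between sets controlled by regularity: an open \<open>U \<supseteq> A\<close> and a compact \<open>K \<subseteq> U\<close>,
  both of almost the same measure as \<open>A\<close>. For \<open>z\<close> near 0 the translate of \<open>K\<close> stays in \<open>U\<close>, so
  \<open>A\<close> moves out of itself only within \<open>U - A\<close> and the translate of \<open>U - K\<close>. The two halves of the
  symmetric difference have equal measure because \<open>A\<close> and its translate do.
\<close>

lemma tendsto_sym_diff_translate_0:
  assumes A: "A \<in> sets borel"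
  shows "((\<lambda>z. measure \<nu> (sym_diff {x. x + z \<in> A} A)) \<longlongrightarrow> 0) (nhds 0)"
proof (rule tendstoI)
  fix e :: real assume "0 < e"
  \<comment> \<open>Two sets of measure less than \<open>d\<close> bound each of the two halves.\<close>
  define d where "d = e / 4"
  have "0 < d" using \<open>0 < e\<close> by (simp add: d_def)
  have "\<exists>U\<in>{U. open U \<and> A \<subseteq> U}. emeasure \<nu> U < emeasure \<nu> A + ennreal d"
    using \<open>0 < d\<close> by (intro INF_approx_ennreal outer_regular[OF A]) simp_all
  then obtain U where U: "open U" "A \<subseteq> U" "emeasure \<nu> U < emeasure \<nu> A + ennreal d"
    by blast
  have "\<exists>K\<in>{K. compact K \<and> K \<subseteq> U}. emeasure \<nu> U < emeasure \<nu> K + ennreal d"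
    using \<open>0 < d\<close> by (intro SUP_approx_ennreal inner_regular[OF U(1)]) auto
  then obtain K where K: "compact K" "K \<subseteq> U" "emeasure \<nu> U < emeasure \<nu> K + ennreal d"
    by blast
  have meas: "measure \<nu> U < measure \<nu> A + d" "measure \<nu> U < measure \<nu> K + d"
    using U(3) K(3) \<open>0 < d\<close> by (simp_all add: emeasure_eq_measure ennreal_less_iff flip: ennreal_plus)
  have [measurable]: "U \<in> sets borel" "K \<in> sets borel" "A \<in> sets borel"
    using U(1) borel_closed[OF compact_imp_closed[OF K(1)]] A by auto
  \<comment> \<open>The tube lemma makes \<open>K - z \<subseteq> U\<close> hold uniformly for \<open>z\<close> in a neighbourhood of 0.\<close>
  have "open ((\<lambda>p. snd p - fst p) -` U)"
    using U(1) by (intro open_vimage continuous_intros)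
  moreover have "{0} \<times> K \<subseteq> (\<lambda>p. snd p - fst p) -` U"
    using K(2) by auto
  ultimately have "\<exists>V. 0 \<in> V \<and> open V \<and> V \<times> K \<subseteq> (\<lambda>p. snd p - fst p) -` U"
    by (rule Elementary_Topology.tube_lemma[OF K(1)])
  then obtain V where V: "0 \<in> V" "open V" "V \<times> K \<subseteq> (\<lambda>p. snd p - fst p) -` U"
    by blast
  have "measure \<nu> (sym_diff {x. x + z \<in> A} A) < e" if "z \<in> V" for z
  proof -
    let ?T = "\<lambda>S. {x. x + z \<in> S}"
    have T: "?T A \<in> sets \<nu>" "?T (U - K) \<in> sets \<nu>"
      unfolding sets_haar by (rule sets_right_translate; measurable)+
    have [simp]: "A \<in> sets \<nu>" "U - A \<in> sets \<nu>"
      unfolding sets_haar by measurable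
    have "?T K \<subseteq> U"
    proof
      fix x assume "x \<in> ?T K"
      then have "(x + z) - z \<in> U" using V(3) that by auto
      then show "x \<in> U" by simp
    qed
    then have "?T A - A \<subseteq> ?T (U - K) \<union> (U - A)"
      using U(2) by auto
    then have "measure \<nu> (?T A - A) \<le> measure \<nu> (?T (U - K) \<union> (U - A))"
      using T by (intro finite_measure_mono sets.Un) simp_all
    also have "\<dots> \<le> measure \<nu> (?T (U - K)) + measure \<nu> (U - A)"
      using T by (intro measure_Un_le) simp_all
    also have "\<dots> = measure \<nu> (U - K) + measure \<nu> (U - A)"
      by (subst measure_right_translate) auto
    also have "\<dots> < 2 * d"
      using meas K(2) U(2) by (simp add: finite_measure_Diff)
    finally have *: "measure \<nu> (?T A - A) < 2 * d" .
    have "measure \<nu> (?T A) = measure \<nu> A"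
      by (rule measure_right_translate[OF A])
    then have "measure \<nu> (A - ?T A) = measure \<nu> (?T A - A)"
      using finite_measure_Diff'[of A "?T A"] finite_measure_Diff'[of "?T A" A] T
      by (simp only: Int_commute[of A]) simp
    moreover have "measure \<nu> (sym_diff (?T A) A) \<le> measure \<nu> (?T A - A) + measure \<nu> (A - ?T A)"
      using T by (intro measure_Un_le sets.Diff) simp_all
    ultimately have "measure \<nu> (sym_diff (?T A) A) < 4 * d"
      using * by linarith
    then show ?thesis by (simp add: d_def)
  qed
  then show "\<forall>\<^sub>F z in nhds 0. dist (measure \<nu> (sym_diff {x. x + z \<in> A} A)) 0 < e"
    using V(1,2) by (auto simp: eventually_nhds intro!: exI[of _ V])
qed

lemma tendsto_sym_diff_translate:
  assumes A: "A \<in> sets borel"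
  shows "((\<lambda>z. measure \<nu> (sym_diff {x. x + z \<in> A} {x. x + w \<in> A})) \<longlongrightarrow> 0) (nhds w)"
proof -
  have eq: "measure \<nu> (sym_diff {x. x + z \<in> A} {x. x + w \<in> A}) =
      measure \<nu> (sym_diff {x. x + (- w + z) \<in> A} A)" for z
  proof -
    have "sym_diff {x. x + (- w + z) \<in> A} A \<in> sets borel"
      using A by (intro sets.Un sets.Diff sets_right_translate)
    moreover have shift: "x + w + (- w + z) = x + z" for x
      by (simp add: add.assoc)
    ultimately show ?thesis
      using measure_right_translate[of "sym_diff {x. x + (- w + z) \<in> A} A" w]
      by (simp add: shift set_diff_eq Un_def)
  qed
  have "((\<lambda>z. - w + z) \<longlongrightarrow> - w + w) (nhds w)"
    by (intro tendsto_intros filterlim_ident)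
  then have "filterlim (\<lambda>z. - w + z) (nhds 0) (nhds w)" by simp
  from filterlim_compose[OF tendsto_sym_diff_translate_0[OF A] this] show ?thesis
    by (simp add: eq)
qed

text \<open>
  The symmetric difference is a pseudometric that controls the measure and is compatible with finite
  intersections, so the induction is on the distance rather than on the measure itself.
\<close>

lemma continuous_measure_Inter_translates:
  fixes c :: "nat \<Rightarrow> 'y::topological_space \<Rightarrow> 'a"
  assumes c: "\<And>i. continuous_on UNIV (c i)" and A: "\<And>i. A i \<in> sets borel"
  shows "continuous_on UNIV (\<lambda>y. measure \<nu> {x. \<forall>i<N. x + c i y \<in> A i})"
proof -
  let ?S = "\<lambda>n y. {x. \<forall>i<n. x + c i y \<in> A i}"
  have S: "?S n y \<in> sets borel" for n y
  proof -
    have "?S n y = (\<Inter>i\<in>{..<n}. {x. x + c i y \<in> A i})" by auto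
    also have "\<dots> \<in> sets borel"
      by (cases n) (auto simp: lessThan_empty_iff intro!: sets.finite_INT sets_right_translate A)
    finally show ?thesis .
  qed
  have T: "{x. x + g \<in> A i} \<in> sets borel" for g i
    by (rule sets_right_translate[OF A])
  have "((\<lambda>y. measure \<nu> (?S N y)) \<longlongrightarrow> measure \<nu> (?S N w)) (nhds w)" for w
  proof -
    have "((\<lambda>y. measure \<nu> (sym_diff (?S n y) (?S n w))) \<longlongrightarrow> 0) (nhds w)" for n
    proof (induction n)
      case 0
      then show ?case by simp
    next
      case (Suc n)
      have "(c n \<longlongrightarrow> c n w) (nhds w)"
        using c[of n] by (simp add: continuous_on_def tendsto_at_iff_tendsto_nhds)
      from tendsto_add[OF Suc filterlim_compose[OF tendsto_sym_diff_translate[OF A[of n]] this]]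
      have lim: "((\<lambda>y. measure \<nu> (sym_diff (?S n y) (?S n w)) +
          measure \<nu> (sym_diff {x. x + c n y \<in> A n} {x. x + c n w \<in> A n})) \<longlongrightarrow> 0) (nhds w)"
        by simp
      have le: "measure \<nu> (sym_diff (?S (Suc n) y) (?S (Suc n) w)) \<le>
          measure \<nu> (sym_diff (?S n y) (?S n w)) +
          measure \<nu> (sym_diff {x. x + c n y \<in> A n} {x. x + c n w \<in> A n})" for y
      proof -
        have "sym_diff (?S (Suc n) y) (?S (Suc n) w) \<subseteq>
          sym_diff (?S n y) (?S n w) \<union> sym_diff {x. x + c n y \<in> A n} {x. x + c n w \<in> A n}"
          by (auto simp: less_Suc_eq)
        then have "measure \<nu> (sym_diff (?S (Suc n) y) (?S (Suc n) w)) \<le>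
          measure \<nu> (sym_diff (?S n y) (?S n w) \<union> sym_diff {x. x + c n y \<in> A n} {x. x + c n w \<in> A n})"
          by (rule finite_measure_mono) (unfold sets_haar, intro sets.Un sets.Diff S T)
        also have "\<dots> \<le> measure \<nu> (sym_diff (?S n y) (?S n w)) +
          measure \<nu> (sym_diff {x. x + c n y \<in> A n} {x. x + c n w \<in> A n})"
          by (rule measure_Un_le; unfold sets_haar; intro sets.Un sets.Diff S T)
        finally show ?thesis .
      qed
      show ?case
        by (rule tendsto_sandwich[OF always_eventually always_eventually tendsto_const lim])
           (intro allI measure_nonneg le)+
    qed
    from this[of N]
    have lim: "((\<lambda>y. measure \<nu> (sym_diff (?S N y) (?S N w))) \<longlongrightarrow> 0) (nhds w)" .
    have "\<bar>measure \<nu> X - measure \<nu> Y\<bar> \<le> measure \<nu> (sym_diff X Y)"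
      if "X \<in> sets borel" "Y \<in> sets borel" for X Y
    proof -
      have "measure \<nu> X \<le> measure \<nu> (Y \<union> sym_diff X Y)" "measure \<nu> Y \<le> measure \<nu> (X \<union> sym_diff X Y)"
        using that by (auto intro!: finite_measure_mono)
      moreover have "measure \<nu> (Y \<union> sym_diff X Y) \<le> measure \<nu> Y + measure \<nu> (sym_diff X Y)"
        "measure \<nu> (X \<union> sym_diff X Y) \<le> measure \<nu> X + measure \<nu> (sym_diff X Y)"
        using that by (auto intro!: measure_Un_le)
      ultimately show ?thesis by linarith
    qed
    then have "((\<lambda>y. measure \<nu> (?S N y) - measure \<nu> (?S N w)) \<longlongrightarrow> 0) (nhds w)"
      by (intro Lim_null_comparison[OF always_eventually lim]) (simp only: real_norm_def S simp_thms)
    then show ?thesis by (simp add: LIM_zero_iff)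
  qed
  then show ?thesis
    unfolding continuous_on_def using tendsto_at_iff_tendsto_nhds[of "\<lambda>y. measure \<nu> (?S N y)"] by blast
qed

section \<open>Open sets of intermediate measure\<close>

text \<open>
  Finitely many translates of \<open>U\<close> cover the compact group, and all have the same measure.
\<close>

lemma open_nonempty_pos:
  assumes "open U" "u \<in> U"
  shows "0 < emeasure \<nu> U"
proof (rule ccontr)
  assume "\<not> 0 < emeasure \<nu> U"
  then have null: "emeasure \<nu> {x. x + g \<in> U} = 0" for g
    using assms(1) by (simp add: emeasure_right_translate)
  have "open {x. x + g \<in> U}" for g
    using open_vimage[OF assms(1), of "\<lambda>x. x + g"] by (simp add: vimage_def continuous_intros)
  moreover have "UNIV \<subseteq> (\<Union>g. {x. x + g \<in> U})"
  proof
    fix x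
    have "x + (- x + u) \<in> U" using assms(2) by simp
    then show "x \<in> (\<Union>g. {x. x + g \<in> U})" by blast
  qed
  ultimately obtain D where D: "finite D" "UNIV \<subseteq> (\<Union>g\<in>D. {x. x + g \<in> U})"
    using compactE_image[OF compact_UNIV, of UNIV "\<lambda>g. {x. x + g \<in> U}"] by metis
  have "(\<Union>g\<in>D. {x. x + g \<in> U}) \<in> null_sets \<nu>"
    using D(1) assms(1)
    by (intro null_sets_UN' null_setsI) (auto simp: null countable_finite intro!: sets_right_translate)
  moreover have "(\<Union>g\<in>D. {x. x + g \<in> U}) = UNIV"
    using D(2) by blast
  ultimately show False by (auto dest: null_setsD1)
qed

lemma ex_open_nontrivial:
  assumes "(UNIV :: 'a set) \<noteq> {0}"
  shows "\<exists>U. open U \<and> 0 < emeasure \<nu> U \<and> emeasure \<nu> U < 1"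
proof -
  obtain g :: 'a where "g \<noteq> 0" using assms by auto
  then obtain U V where UV: "open U" "open V" "0 \<in> U" "g \<in> V" "U \<inter> V = {}"
    using hausdorff[of 0 g] by metis
  have "0 < emeasure \<nu> U" "0 < emeasure \<nu> V"
    using UV by (auto intro: open_nonempty_pos)
  moreover have "emeasure \<nu> U + emeasure \<nu> V \<le> 1"
    using UV plus_emeasure[of U \<nu> V] emeasure_space[of \<nu> "U \<union> V"] by simp
  ultimately show ?thesis
    using UV(1) by (intro exI[of _ U]) (auto simp: emeasure_eq_measure simp flip: ennreal_plus)
qed

end



section \<open>Trajectories with given present value and noise\<close>

text \<open>
  \<open>drift y n\<close> is \<open>- \<eta>\<^sub>0 + \<eta>\<^sub>n\<close> for every path with noise \<open>y\<close>: solving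
  \<open>\<xi>\<^sub>n = - \<eta>\<^bsub>n+1\<^esub> + \<eta>\<^sub>n\<close> for the earlier time gives \<open>\<eta>\<^bsub>n+1\<^esub> = \<eta>\<^sub>n - \<xi>\<^sub>n\<close>.
\<close>

primrec drift :: "(nat \<Rightarrow> 'a::group_add) \<Rightarrow> nat \<Rightarrow> 'a" where
  "drift y 0 = 0"
| "drift y (Suc n) = drift y n - y n"

definition trajectory :: "'a::group_add \<Rightarrow> (nat \<Rightarrow> 'a) \<Rightarrow> nat \<Rightarrow> 'a" where
  "trajectory x y n = x + drift y n"

lemma eta_trajectory: "eta n (trajectory x y) = x + drift y n"
  by (simp add: eta_def trajectory_def)

lemma xi_trajectory: "xi n (trajectory x y) = y n"
  by (simp add: xi_def eta_trajectory minus_add minus_diff_eq add.assoc diff_conv_add_uminus del: add_uminus_conv_diff)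

lemma drift_upd_le: "m \<le> n \<Longrightarrow> drift (y(n := t)) m = drift y m"
  by (induction m) auto

text \<open>
  A change of \<open>y n\<close> multiplies all later drifts on the left by the same group element, which the
  present value can absorb by a right translation.
\<close>

lemma drift_upd:
  assumes "Suc n \<le> m"
  shows "drift (y(n := t)) m = (drift y n - t + y n - drift y n) + drift y m"
proof -
  define z where "z = y(n := t)"
  have z: "z n = t" "i \<noteq> n \<Longrightarrow> z i = y i" "drift z n = drift y n" for i
    by (simp_all add: z_def drift_upd_le)
  from assms have "drift z m = (drift y n - t + y n - drift y n) + drift y m"
  proof (induction m rule: dec_induct)
    case base
    show ?case by (simp add: z add.assoc diff_conv_add_uminus del: add_uminus_conv_diff)
  next
    case (step m)
    then show ?case
      by (simp add: z add.assoc diff_conv_add_uminus del: add_uminus_conv_diff)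
  qed
  then show ?thesis by (simp add: z_def)
qed

lemma continuous_on_drift:
  "continuous_on UNIV (\<lambda>y :: nat \<Rightarrow> 'a::topological_group_add. drift y n)"
proof (induction n)
  case (Suc n)
  have "continuous_on UNIV (\<lambda>y :: nat \<Rightarrow> 'a. y n)"
    by (rule continuous_on_product_coordinates)
  with Suc show ?case by (simp add: continuous_intros)
qed simp

section \<open>The path space\<close>

lemma sigma_sets_saturated:
  assumes "C \<in> sigma_sets UNIV (\<Union>m\<in>I. sigma_rv (X m))" and "\<And>m. m \<in> I \<Longrightarrow> X m \<omega> = X m \<omega>'"
  shows "\<omega> \<in> C \<longleftrightarrow> \<omega>' \<in> C"
  using assms by (induction rule: sigma_sets.induct) (auto simp: sigma_rv_def)

lemma sigma_rv_subset_sets: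
  assumes "space M = UNIV" "X \<in> borel_measurable M"
  shows "sigma_rv X \<subseteq> sets M"
  using measurable_sets[OF assms(2)] assms(1) by (auto simp: sigma_rv_def)

lemma F_eta_subset_path_space: "F_eta n \<subseteq> sets path_space"
  unfolding F_eta_def
  by (rule sets.sigma_sets_subset[of _ path_space, unfolded space_path_space])
     (intro UN_least sigma_rv_subset_sets space_path_space measurable_eta)

lemma F_xi_subset_path_space: "F_xi n \<subseteq> sets path_space"
  unfolding F_xi_def
  by (rule sets.sigma_sets_subset[of _ path_space, unfolded space_path_space])
     (intro UN_least sigma_rv_subset_sets space_path_space measurable_xi)

text \<open>
  The noise coordinates are listed next to the path coordinates because without second countability
  they need not be measurable functions of the latter.
\<close>

definition cylinders :: "(nat \<Rightarrow> 'a::{topological_space, group_add}) set set" where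
  "cylinders = {{\<omega>. \<forall>i<N. eta i \<omega> \<in> A i \<and> xi i \<omega> \<in> B i} | N A B.
     range A \<subseteq> sets borel \<and> range B \<subseteq> sets borel}"

lemma cylinders_I:
  "range A \<subseteq> sets borel \<Longrightarrow> range B \<subseteq> sets borel \<Longrightarrow>
   {\<omega>. \<forall>i<N. eta i \<omega> \<in> A i \<and> xi i \<omega> \<in> B i} \<in> cylinders"
  unfolding cylinders_def by blast

lemma cylinders_E:
  assumes "C \<in> cylinders"
  obtains N A B where "C = {\<omega>. \<forall>i<N. eta i \<omega> \<in> A i \<and> xi i \<omega> \<in> B i}"
    "\<And>i. A i \<in> sets borel" "\<And>i. B i \<in> sets borel"
  using assms unfolding cylinders_def by auto

lemma Int_stable_cylinders: "Int_stable cylinders"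
proof (rule Int_stableI)
  fix C D :: "(nat \<Rightarrow> 'a) set"
  assume "C \<in> cylinders" "D \<in> cylinders"
  from \<open>C \<in> cylinders\<close> obtain N A B where
      C: "C = {\<omega>. \<forall>i<N. eta i \<omega> \<in> A i \<and> xi i \<omega> \<in> B i}" "\<And>i. A i \<in> sets borel" "\<And>i. B i \<in> sets borel"
    by (rule cylinders_E) auto
  from \<open>D \<in> cylinders\<close> obtain N' A' B' where
      D: "D = {\<omega>. \<forall>i<N'. eta i \<omega> \<in> A' i \<and> xi i \<omega> \<in> B' i}" "\<And>i. A' i \<in> sets borel" "\<And>i. B' i \<in> sets borel"
    by (rule cylinders_E) auto
  let ?cut = "\<lambda>n S i. if i < n then S i else UNIV :: 'a set"
  have "C \<inter> D = {\<omega>. \<forall>i<max N N'. eta i \<omega> \<in> ?cut N A i \<inter> ?cut N' A' i \<and> xi i \<omega> \<in> ?cut N B i \<inter> ?cut N' B' i}"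
    unfolding C D by (auto simp: less_max_iff_disj)
  moreover have "range (\<lambda>i. ?cut N A i \<inter> ?cut N' A' i) \<subseteq> sets borel"
      "range (\<lambda>i. ?cut N B i \<inter> ?cut N' B' i) \<subseteq> sets borel"
    using C(2,3) D(2,3) by (auto intro!: sets.Int)
  ultimately show "C \<inter> D \<in> cylinders"
    by (simp only: cylinders_I)
qed

lemma sets_path_space_eq_cylinders:
  "sets path_space = sigma_sets UNIV (cylinders :: (nat \<Rightarrow> 'a::{topological_space, group_add}) set set)"
proof
  have "eta n -` S \<in> cylinders" "xi n -` S \<in> cylinders" if "S \<in> sets borel" for n and S :: "'a set"
  proof -
    have "eta n -` S = {\<omega>. \<forall>i<Suc n. eta i \<omega> \<in> ((\<lambda>_. UNIV)(n := S)) i \<and> xi i \<omega> \<in> UNIV}"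
      "xi n -` S = {\<omega>. \<forall>i<Suc n. eta i \<omega> \<in> UNIV \<and> xi i \<omega> \<in> ((\<lambda>_. UNIV)(n := S)) i}"
      by auto
    moreover have "range ((\<lambda>_. UNIV)(n := S)) \<subseteq> sets borel" "range (\<lambda>_::nat. UNIV :: 'a set) \<subseteq> sets borel"
      using that by auto
    ultimately show "eta n -` S \<in> cylinders" "xi n -` S \<in> cylinders"
      using cylinders_I[of "(\<lambda>_. UNIV)(n := S)" "\<lambda>_. UNIV" "Suc n"]
        cylinders_I[of "\<lambda>_. UNIV" "(\<lambda>_. UNIV)(n := S)" "Suc n"] by simp_all
  qed
  then show "sets path_space \<subseteq> sigma_sets UNIV (cylinders :: (nat \<Rightarrow> 'a) set set)"
    unfolding sets_path_space sigma_rv_def by (intro sigma_sets_mono) (blast intro: sigma_sets.Basic)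
  have "C \<in> sets path_space" if "C \<in> cylinders" for C :: "(nat \<Rightarrow> 'a) set"
  proof -
    obtain N A B where C: "C = {\<omega>. \<forall>i<N. eta i \<omega> \<in> A i \<and> xi i \<omega> \<in> B i}"
      and [measurable]: "\<And>i. A i \<in> sets borel" "\<And>i. B i \<in> sets borel"
      by (rule cylinders_E[OF \<open>C \<in> cylinders\<close>]) auto
    have "{\<omega> \<in> space path_space. \<forall>i\<in>{..<N}. eta i \<omega> \<in> A i \<and> xi i \<omega> \<in> B i} \<in> sets path_space"
      by measurable
    then show ?thesis
      by (simp add: C space_path_space Ball_def)
  qed
  then show "sigma_sets UNIV (cylinders :: (nat \<Rightarrow> 'a) set set) \<subseteq> sets path_space"
    using sets.sigma_sets_subset[of cylinders path_space] by (auto simp: space_path_space)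
qed

section \<open>The uniform solution\<close>

locale haar_noise = compact_group_haar \<nu>
  for \<nu> :: "'a::{topological_group_add, t2_space} measure" +
  fixes \<mu> :: "nat \<Rightarrow> 'a measure"
  assumes noise: "noise_law \<mu>"
begin

lemma prob_space_noise: "prob_space (\<mu> n)"
  and sets_noise [measurable_cong, simp]: "sets (\<mu> n) = sets borel"
  using noise by (auto simp: noise_law_def)

lemma space_noise [simp]: "space (\<mu> n) = UNIV"
  using sets_noise[THEN sets_eq_imp_space_eq] by simp

abbreviation noise_measure :: "(nat \<Rightarrow> 'a) measure" where
  "noise_measure \<equiv> PiM UNIV \<mu>"

sublocale noise: prob_space noise_measure
  by (intro prob_space_PiM prob_space_noise)

lemma space_noise_measure [simp]: "space noise_measure = UNIV"
  by (simp add: space_PiM)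

lemma measurable_trajectory [measurable]: "(\<lambda>x. trajectory x y) \<in> measurable \<nu> path_space"
  unfolding path_space_def
proof (rule measurable_measure_of)
  fix S assume "S \<in> (\<Union>n. sigma_rv (eta n) \<union> sigma_rv (xi n) :: (nat \<Rightarrow> 'a) set set)"
  then obtain n T where T: "T \<in> sets borel" and "S = eta n -` T \<or> S = xi n -` T"
    by (auto simp: sigma_rv_def)
  then have "(\<lambda>x. trajectory x y) -` S = {x. x + drift y n \<in> T} \<or> (\<lambda>x. trajectory x y) -` S \<in> {UNIV, {}}"
    by (auto simp: vimage_def eta_trajectory xi_trajectory)
  then show "(\<lambda>x. trajectory x y) -` S \<inter> space \<nu> \<in> sets \<nu>"
    using sets_right_translate[OF T] by auto
qed auto

definition trajectory_law :: "(nat \<Rightarrow> 'a) \<Rightarrow> (nat \<Rightarrow> 'a) measure" where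
  "trajectory_law y = distr \<nu> path_space (\<lambda>x. trajectory x y)"

lemma sets_fibre:
  fixes C :: "(nat \<Rightarrow> 'a) set"
  assumes "C \<in> sets path_space"
  shows "{x. trajectory x y \<in> C} \<in> sets borel"
  using measurable_sets[OF measurable_trajectory assms, of y] by (simp add: vimage_def)

lemma emeasure_trajectory_law:
  "C \<in> sets path_space \<Longrightarrow> emeasure (trajectory_law y) C = emeasure \<nu> {x. trajectory x y \<in> C}"
  by (simp add: trajectory_law_def emeasure_distr vimage_def)

text \<open>
  The fibre of a cylinder over \<open>y\<close> is empty unless \<open>y\<close> satisfies the conditions on the noise; then it
  is a finite intersection of right translates, whose measure is continuous in \<open>y\<close>.
\<close>

lemma measurable_trajectory_law: "trajectory_law \<in> measurable noise_measure (prob_algebra path_space)"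
proof (rule measurable_prob_algebra_generated[OF sets_path_space_eq_cylinders Int_stable_cylinders])
  fix C :: "(nat \<Rightarrow> 'a) set" assume C: "C \<in> cylinders"
  then obtain N A B where C_eq: "C = {\<omega>. \<forall>i<N. eta i \<omega> \<in> A i \<and> xi i \<omega> \<in> B i}"
    and A: "\<And>i. A i \<in> sets borel" and B [measurable]: "\<And>i. B i \<in> sets borel"
    by (rule cylinders_E) auto
  have "(\<lambda>y. measure \<nu> {x. \<forall>i<N. x + drift y i \<in> A i}) \<in> borel_measurable noise_measure"
    by (intro continuous_imp_measurable_PiM compact_UNIV sets_noise continuous_on_drift
        continuous_measure_Inter_translates A)
  moreover have "Measurable.pred noise_measure (\<lambda>y. \<forall>i\<in>{..<N}. y i \<in> B i)"
    by measurable
  ultimately have "(\<lambda>y. if \<forall>i\<in>{..<N}. y i \<in> B i then ennreal (measure \<nu> {x. \<forall>i<N. x + drift y i \<in> A i}) else 0)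
      \<in> borel_measurable noise_measure"
    by measurable
  moreover have "C \<in> sets path_space"
    unfolding sets_path_space_eq_cylinders using C by blast
  then have "emeasure (trajectory_law y) C =
      (if \<forall>i\<in>{..<N}. y i \<in> B i then ennreal (measure \<nu> {x. \<forall>i<N. x + drift y i \<in> A i}) else 0)" for y
  proof (cases "\<forall>i\<in>{..<N}. y i \<in> B i")
    case True
    then have "{x. trajectory x y \<in> C} = {x. \<forall>i<N. x + drift y i \<in> A i}"
      by (auto simp: C_eq eta_trajectory xi_trajectory)
    then show ?thesis
      using True \<open>C \<in> sets path_space\<close> by (simp add: emeasure_trajectory_law emeasure_eq_measure)
  next
    case False
    then have "{x. trajectory x y \<in> C} = {}"
      by (auto simp: C_eq xi_trajectory)
    then show ?thesis
      using False \<open>C \<in> sets path_space\<close> by (auto simp: emeasure_trajectory_law)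
  qed
  ultimately show "(\<lambda>y. emeasure (trajectory_law y) C) \<in> borel_measurable noise_measure"
    by (simp only:)
qed (auto simp: trajectory_law_def intro!: prob_space_distr)

definition haar_solution :: "(nat \<Rightarrow> 'a) measure" where
  "haar_solution = noise_measure \<bind> trajectory_law"

lemma noise_measure_in_prob_algebra: "noise_measure \<in> space (prob_algebra noise_measure)"
  by (simp add: space_prob_algebra noise.prob_space_axioms)

lemma sets_haar_solution [measurable_cong, simp]: "sets haar_solution = sets path_space"
  unfolding haar_solution_def
  by (rule sets_bind'[OF noise_measure_in_prob_algebra measurable_trajectory_law])

sublocale sol: prob_space haar_solution
  unfolding haar_solution_def
  by (rule prob_space_bind'[OF noise_measure_in_prob_algebra measurable_trajectory_law])

lemma space_haar_solution [simp]: "space haar_solution = UNIV"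
  using sets_haar_solution[THEN sets_eq_imp_space_eq] by (simp add: space_path_space)

lemma measurable_fibre:
  assumes "C \<in> sets path_space"
  shows "(\<lambda>y. emeasure \<nu> {x. trajectory x y \<in> C}) \<in> borel_measurable noise_measure"
  using measurable_compose[OF measurable_prob_algebraD[OF measurable_trajectory_law]
      measurable_emeasure_subprob_algebra[OF assms]]
  by (simp add: emeasure_trajectory_law[OF assms])

lemma emeasure_haar_solution:
  assumes "C \<in> sets path_space"
  shows "emeasure haar_solution C = (\<integral>\<^sup>+ y. emeasure \<nu> {x. trajectory x y \<in> C} \<partial>noise_measure)"
  unfolding haar_solution_def
  using emeasure_bind_prob_algebra[OF noise_measure_in_prob_algebra measurable_trajectory_law assms]
  by (simp add: emeasure_trajectory_law[OF assms])

text \<open>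
  Coordinates of a product measure are independent, so the \<open>n\<close>-th one may be redrawn.
\<close>

lemma nn_integral_resample:
  assumes f [measurable]: "f \<in> borel_measurable noise_measure"
  shows "(\<integral>\<^sup>+ y. f y \<partial>noise_measure) = (\<integral>\<^sup>+ y. \<integral>\<^sup>+ t. f (y(n := t)) \<partial>\<mu> n \<partial>noise_measure)"
proof -
  interpret pair_prob_space "\<mu> n" noise_measure
    by (simp add: pair_prob_space_def pair_sigma_finite_def prob_space_noise noise.prob_space_axioms
        prob_space_imp_sigma_finite)
  have upd: "(\<lambda>(t, y). y(n := t)) \<in> measurable (\<mu> n \<Otimes>\<^sub>M noise_measure) noise_measure"
    using measurable_fun_upd[of UNIV UNIV n snd "\<mu> n \<Otimes>\<^sub>M noise_measure" \<mu> fst]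
    by (simp add: split_beta')
  have "noise_measure = distr (\<mu> n \<Otimes>\<^sub>M noise_measure) noise_measure (\<lambda>(t, y). y(n := t))"
    using distr_pair_PiM_eq_PiM[of UNIV \<mu> n] prob_space_noise by simp
  then have "(\<integral>\<^sup>+ y. f y \<partial>noise_measure) =
      (\<integral>\<^sup>+ y. f y \<partial>distr (\<mu> n \<Otimes>\<^sub>M noise_measure) noise_measure (\<lambda>(t, y). y(n := t)))"
    by simp
  also have "\<dots> = (\<integral>\<^sup>+ p. f ((\<lambda>(t, y). y(n := t)) p) \<partial>(\<mu> n \<Otimes>\<^sub>M noise_measure))"
    by (rule nn_integral_distr[OF upd]) simp
  also have "\<dots> = (\<integral>\<^sup>+ y. \<integral>\<^sup>+ t. f (y(n := t)) \<partial>\<mu> n \<partial>noise_measure)"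
    using nn_integral_snd[of "\<lambda>p. f ((\<lambda>(t, y). y(n := t)) p)"] measurable_compose[OF upd f]
    by simp
  finally show ?thesis .
qed

section \<open>Marginals and independence\<close>

lemma distr_eta_haar_solution: "distr haar_solution borel (eta n) = \<nu>"
proof (rule measure_eqI)
  fix A assume "A \<in> sets (distr haar_solution borel (eta n))"
  then have A: "A \<in> sets borel" by simp
  have "eta n -` A \<in> sets path_space"
    using measurable_sets[OF measurable_eta A] by (simp add: space_path_space)
  then have "emeasure haar_solution (eta n -` A) = emeasure \<nu> A"
    by (simp add: emeasure_haar_solution eta_trajectory emeasure_right_translate A noise.emeasure_space_1[simplified])
  then show "emeasure (distr haar_solution borel (eta n)) A = emeasure \<nu> A"
    using A by (subst emeasure_distr) auto
qed simp

lemma distr_xi_haar_solution: "distr haar_solution borel (xi n) = \<mu> n"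
proof (rule measure_eqI)
  fix B assume "B \<in> sets (distr haar_solution borel (xi n))"
  then have B: "B \<in> sets borel" by simp
  have "xi n -` B \<in> sets path_space"
    using measurable_sets[OF measurable_xi B] by (simp add: space_path_space)
  then have "emeasure haar_solution (xi n -` B) = (\<integral>\<^sup>+ y. indicator B (y n) \<partial>noise_measure)"
    by (auto simp: emeasure_haar_solution xi_trajectory indicator_def intro!: nn_integral_cong)
  also have "\<dots> = emeasure (\<mu> n) B"
    using B by (subst nn_integral_resample[of _ n]) (auto simp: noise.emeasure_space_1[simplified])
  finally show "emeasure (distr haar_solution borel (xi n)) B = emeasure (\<mu> n) B"
    using B by (subst emeasure_distr) auto
qed simp

text \<open>
  The core of the independence of \<open>\<xi>\<^sub>n\<close> from the past: on the times beyond \<open>n\<close>, resampling \<open>y n\<close>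
  amounts to a right translation of the present value, which Haar measure does not see.
\<close>

lemma fibre_resample:
  assumes C: "C \<in> F_eta (Suc n)"
  shows "emeasure \<nu> {x. trajectory x (y(n := t)) \<in> C} = emeasure \<nu> {x. trajectory x y \<in> C}"
proof -
  \<comment> \<open>This is the translation by which the present value absorbs the change of the noise at \<open>n\<close>.\<close>
  define w where "w = drift y n - t + y n - drift y n"
  have "trajectory x (y(n := t)) \<in> C \<longleftrightarrow> trajectory (x + w) y \<in> C" for x
  proof (rule sigma_sets_saturated[OF C[unfolded F_eta_def]])
    fix m assume "m \<in> {Suc n..}"
    then show "eta m (trajectory x (y(n := t))) = eta m (trajectory (x + w) y)"
      by (simp add: eta_trajectory drift_upd w_def add.assoc)
  qed
  then show ?thesis
    using emeasure_right_translate[OF sets_fibre[of C y], of w] C F_eta_subset_path_space by auto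
qed

lemma emeasure_xi_inter_past:
  assumes B: "B \<in> sets borel" and C: "C \<in> F_eta (Suc n)"
  shows "emeasure haar_solution (xi n -` B \<inter> C) = emeasure haar_solution (xi n -` B) * emeasure haar_solution C"
proof -
  let ?h = "\<lambda>y. emeasure \<nu> {x. trajectory x y \<in> C}"
  have C': "C \<in> sets path_space"
    using C F_eta_subset_path_space by auto
  have B': "xi n -` B \<in> sets path_space"
    using measurable_sets[OF measurable_xi B] by (simp add: space_path_space)
  note [measurable] = measurable_fibre[OF C'] B
  have "emeasure haar_solution (xi n -` B \<inter> C) = (\<integral>\<^sup>+ y. indicator B (y n) * ?h y \<partial>noise_measure)"
    using sets.Int[OF B' C']
    by (auto simp: emeasure_haar_solution xi_trajectory indicator_def intro!: nn_integral_cong)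
  also have "\<dots> = (\<integral>\<^sup>+ y. \<integral>\<^sup>+ t. indicator B t * ?h y \<partial>\<mu> n \<partial>noise_measure)"
    by (subst nn_integral_resample[of _ n]) (simp_all add: fibre_resample[OF C])
  also have "\<dots> = (\<integral>\<^sup>+ y. emeasure (\<mu> n) B * ?h y \<partial>noise_measure)"
    by (simp add: nn_integral_multc)
  also have "\<dots> = emeasure (\<mu> n) B * emeasure haar_solution C"
    by (simp add: nn_integral_cmult emeasure_haar_solution[OF C'])
  also have "emeasure (\<mu> n) B = emeasure haar_solution (xi n -` B)"
    using B by (subst distr_xi_haar_solution[of n, symmetric], subst emeasure_distr) auto
  finally show ?thesis .
qed

lemma haar_solution_in_solutions: "haar_solution \<in> solutions \<mu>"
proof -
  have "sol.indep_set (sigma_rv (xi n)) (F_eta (Suc n))" for n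
  proof (rule sol.indep_setI)
    show "sigma_rv (xi n) \<subseteq> sol.events"
      by (intro sigma_rv_subset_sets) auto
    show "F_eta (Suc n) \<subseteq> sol.events"
      using F_eta_subset_path_space by simp
  next
    fix S C assume "S \<in> sigma_rv (xi n :: (nat \<Rightarrow> 'a) \<Rightarrow> 'a)" "C \<in> (F_eta (Suc n) :: (nat \<Rightarrow> 'a) set set)"
    then show "sol.prob (S \<inter> C) = sol.prob S * sol.prob C"
      using emeasure_xi_inter_past[of _ C n] by (auto simp: sigma_rv_def measure_def enn2real_mult)
  qed
  then show ?thesis
    by (simp add: solutions_def sol.prob_space_axioms distr_xi_haar_solution)
qed

section \<open>Failure of strongness\<close>

text \<open>
  The noise of \<open>trajectory x y\<close> is \<open>y\<close>, whatever \<open>x\<close>, so a fibre of a noise event is either empty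
  or the whole group.
\<close>

lemma emeasure_eta_0_inter_noise:
  assumes A: "A \<in> sets borel" and C: "C \<in> F_xi 0"
  shows "emeasure haar_solution (eta 0 -` A \<inter> C) = emeasure \<nu> A * emeasure haar_solution C"
proof -
  have C': "C \<in> sets path_space"
    using C F_xi_subset_path_space by auto
  have A': "eta 0 -` A \<in> sets path_space"
    using measurable_sets[OF measurable_eta A] by (simp add: space_path_space)
  have "trajectory x y \<in> C \<longleftrightarrow> trajectory 0 y \<in> C" for x y
    using C by (intro sigma_sets_saturated[of C xi "{0..}"]) (simp_all add: F_xi_def xi_trajectory)
  then have fibre: "{x. trajectory x y \<in> C} = (if trajectory 0 y \<in> C then UNIV else {})" for y
    by auto
  then have "{x. trajectory x y \<in> eta 0 -` A \<inter> C} = (if trajectory 0 y \<in> C then A else {})" for y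
    using \<open>\<And>x y. trajectory x y \<in> C \<longleftrightarrow> trajectory 0 y \<in> C\<close>[of _ y] by (auto simp: eta_trajectory)
  then have "emeasure \<nu> {x. trajectory x y \<in> eta 0 -` A \<inter> C} = emeasure \<nu> A * emeasure \<nu> {x. trajectory x y \<in> C}" for y
    by (simp add: fibre)
  then show ?thesis
    using measurable_fibre[OF C']
    by (simp add: emeasure_haar_solution[OF C'] emeasure_haar_solution[OF sets.Int[OF A' C']] nn_integral_cmult)
qed

text \<open>
  If \<open>\<eta>\<^sub>0 \<in> U\<close> agreed almost surely with a noise event, it would be independent of itself, and \<open>\<nu> U\<close>
  would be a solution of \<open>p = p * p\<close>.
\<close>

lemma haar_solution_not_strong:
  assumes "(UNIV :: 'a set) \<noteq> {0}"
  shows "\<not> strong_solution haar_solution"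
proof
  assume strong: "strong_solution haar_solution"
  obtain U where U: "open U" "0 < emeasure \<nu> U" "emeasure \<nu> U < 1"
    using ex_open_nontrivial[OF assms] by blast
  let ?A = "eta 0 -` U"
  have "?A \<in> F_eta 0"
    unfolding F_eta_def sigma_rv_def
    by (rule sigma_sets.Basic, rule UN_I[of 0]) (use borel_open[OF U(1)] in auto)
  from strong[unfolded strong_solution_def, THEN spec, THEN bspec, OF this]
  obtain C where C: "C \<in> F_xi 0" and null: "(?A - C) \<union> (C - ?A) \<in> null_sets haar_solution"
    by (rule bexE)
  have A': "?A \<in> sets path_space" and C': "C \<in> sets path_space"
    using \<open>?A \<in> F_eta 0\<close> C F_eta_subset_path_space F_xi_subset_path_space by auto
  have AE: "AE \<omega> in haar_solution. \<omega> \<in> ?A \<longleftrightarrow> \<omega> \<in> C"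
    by (rule AE_I'[OF null]) auto
  have "emeasure (distr haar_solution borel (eta 0)) U = emeasure haar_solution ?A"
    using U(1) by (subst emeasure_distr) auto
  then have law: "emeasure haar_solution ?A = emeasure \<nu> U"
    by (simp only: distr_eta_haar_solution)
  have "emeasure haar_solution C = emeasure haar_solution ?A"
    by (rule emeasure_eq_AE) (use AE A' C' in auto)
  then have C_eq: "emeasure haar_solution C = emeasure \<nu> U"
    using law by (rule trans)
  have "emeasure haar_solution ?A = emeasure haar_solution (?A \<inter> C)"
    by (rule emeasure_eq_AE) (use AE A' C' in auto)
  also have "\<dots> = emeasure \<nu> U * emeasure \<nu> U"
    using emeasure_eta_0_inter_noise[OF borel_open[OF U(1)] C] unfolding C_eq .
  finally have "emeasure \<nu> U = emeasure \<nu> U * emeasure \<nu> U"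
    unfolding law .
  then have "measure \<nu> U = measure \<nu> U * measure \<nu> U"
    unfolding measure_def enn2real_mult[symmetric] by (rule arg_cong)
  moreover have "0 < measure \<nu> U" "measure \<nu> U < 1"
    using U(2,3) unfolding emeasure_eq_measure by simp_all
  ultimately show False
    using mult_strict_left_mono[of "measure \<nu> U" 1 "measure \<nu> U"] by linarith
qed

end

theorem theorem1p2:
  fixes \<mu> :: "nat \<Rightarrow> 'a::{topological_group_add, t2_space} measure"
    and \<nu> :: "'a measure"
  assumes "compact (UNIV :: 'a set)"
    and "noise_law \<mu>"
    and "normalized_haar \<nu>"
  shows "\<exists>P \<in> solutions \<mu>.
           (\<forall>n. distr P borel (eta n) = \<nu>) \<and>
           ((UNIV :: 'a set) \<noteq> {0} \<longrightarrow> \<not> strong_solution P)"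
proof -
  interpret haar_noise \<nu> \<mu>
    using assms by unfold_locales
  show ?thesis
    by (intro bexI[OF _ haar_solution_in_solutions] conjI allI impI
        distr_eta_haar_solution haar_solution_not_strong)
qed

end
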